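(* For every $n\ge1$, $$\sum_{F\in F(n)}\prod_{h\in\mathcal{H}(F)}\frac{1}{h^2}=\frac{(n+1)!}{2^n}.$$
   Context: $F(n)$ is the set of labeled forests on $\{1,\dots,n\}$, i.e. sets of rooted labeled trees (children unordered) whose vertex sets partition $\{1,\dots,n\}$. For a vertex $u$ of $F$, the hook length $h_u$ is the number of descendants of $u$ (counting $u$ itself), and $\mathcal{H}(F)$ is the multiset of hook lengths of all vertices; the product is over all vertices. *)

theory Defs
  imports Complex_Main "HOL-Library.FSet" "HOL-Library.Multiset" "HOL-Library.Disjoint_Sets"
begin

datatype (labels: 'a) rtree = Node (root: 'a) (children: "'a rtree fset")

text \<open>In a labeled tree every vertex carries its own label. A vertex is then identified with its
  label, and collecting the children in a set loses nothing, since siblings are distinct.\<close>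

inductive labeled_tree :: "'a rtree \<Rightarrow> bool" where
  "\<lbrakk>a \<notin> (\<Union>t\<in>fset ts. labels t); disjoint_family_on labels (fset ts);
    \<And>t. t |\<in>| ts \<Longrightarrow> labeled_tree t\<rbrakk> \<Longrightarrow> labeled_tree (Node a ts)"

text \<open>The vertex sets form a partition as a family indexed by the trees, so two different trees on
  the same vertex set are excluded; nonemptiness of the blocks is automatic.\<close>

definition forests_on :: "'a set \<Rightarrow> 'a rtree set set" where
  "forests_on A = {F. (\<forall>t\<in>F. labeled_tree t) \<and> disjoint_family_on labels F \<and> (\<Union>t\<in>F. labels t) = A}"

abbreviation labeled_forests :: "nat \<Rightarrow> nat rtree set set" where
  "labeled_forests n \<equiv> forests_on {1..n}"

definition vertices :: "'a rtree set \<Rightarrow> 'a set" where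
  "vertices F = (\<Union>t\<in>F. labels t)"

inductive subtree :: "'a rtree \<Rightarrow> 'a rtree \<Rightarrow> bool" where
  "subtree t t"
| "\<lbrakk>subtree s t; t |\<in>| ts\<rbrakk> \<Longrightarrow> subtree s (Node a ts)"

definition descendants :: "'a rtree set \<Rightarrow> 'a \<Rightarrow> 'a set" where
  "descendants F u = {v. \<exists>t\<in>F. \<exists>s. subtree s t \<and> root s = u \<and> v \<in> labels s}"

definition hook_length :: "'a rtree set \<Rightarrow> 'a \<Rightarrow> nat" where
  "hook_length F u = card (descendants F u)"

definition hook_lengths :: "'a rtree set \<Rightarrow> nat multiset" where
  "hook_lengths F = image_mset (hook_length F) (mset_set (vertices F))"

end

theory Submission imports Defs begin

text \<open>
  Write \<open>f n\<close> for the sum over the forests on \<open>n\<close> labels. Deleting the root of a tree on \<open>n\<close> labels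
  leaves an arbitrary forest on the others, so the trees sum to \<open>n * (1 / n\<^sup>2) * f (n - 1)\<close>. Splitting
  off the tree that contains a fixed label gives
  \<open>f (m + 1) = (\<Sum>j\<le>m. (m choose j) * (f j / (j + 1)) * f (m - j))\<close>, and for
  \<open>f n = (n + 1)! / 2 ^ n\<close> the \<open>j\<close>-th summand is just \<open>m! * (m - j + 1) / 2 ^ m\<close>.
\<close>

definition trees_on :: "'a set \<Rightarrow> 'a rtree set" where
  "trees_on A = {t. labeled_tree t \<and> labels t = A}"

text \<open>The weight \<open>q\<close> stays arbitrary because both recurrences below hold for
  every \<open>q\<close>; only the closing evaluation specialises to inverse squares.\<close>

definition hook_weight :: "(nat \<Rightarrow> 'b::comm_semiring_1) \<Rightarrow> 'a rtree set \<Rightarrow> 'b" where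
  "hook_weight q F = (\<Prod>u\<in>vertices F. q (hook_length F u))"

definition forest_sum :: "(nat \<Rightarrow> 'b::comm_semiring_1) \<Rightarrow> 'a set \<Rightarrow> 'b" where
  "forest_sum q A = (\<Sum>F\<in>forests_on A. hook_weight q F)"

definition tree_sum :: "(nat \<Rightarrow> 'b::comm_semiring_1) \<Rightarrow> 'a set \<Rightarrow> 'b" where
  "tree_sum q A = (\<Sum>t\<in>trees_on A. hook_weight q {t})"

section \<open>Structure of labeled trees and forests\<close>

lemma root_in_labels: "root t \<in> labels t"
  by (cases t) simp

lemma finite_labels: "finite (labels t)"
  by (induction t) auto

lemma labeled_tree_Node_iff:
  "labeled_tree (Node a ts) \<longleftrightarrow>
     a \<notin> (\<Union>t\<in>fset ts. labels t) \<and> disjoint_family_on labels (fset ts) \<and>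
     (\<forall>t\<in>fset ts. labeled_tree t)"
  by (subst labeled_tree.simps) auto

text \<open>The form behind root deletion: the children of a labeled tree are a forest on the
  remaining labels.\<close>

lemma labeled_tree_Node_iff_forest:
  "labeled_tree (Node a ts) \<longleftrightarrow>
     a \<notin> vertices (fset ts) \<and> fset ts \<in> forests_on (vertices (fset ts))"
  by (auto simp: labeled_tree_Node_iff forests_on_def vertices_def)

lemma labels_Node: "labels (Node a ts) = insert a (vertices (fset ts))"
  by (simp add: vertices_def)

lemma vertices_forest: "F \<in> forests_on A \<Longrightarrow> vertices F = A"
  by (simp add: forests_on_def vertices_def)

lemma forest_unique_tree:
  assumes "F \<in> forests_on A" "t \<in> F" "t' \<in> F" "u \<in> labels t" "u \<in> labels t'"
  shows "t = t'"
  using assms unfolding forests_on_def disjoint_family_on_def by blast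

text \<open>Trees of a forest share no label, so \<open>root\<close> maps \<open>F\<close>
  injectively into \<open>A\<close>. This allows \<open>F\<close> to be stored as an
  \<open>fset\<close> of children.\<close>

lemma finite_forest:
  assumes "finite A" "F \<in> forests_on A"
  shows "finite F"
proof -
  have "inj_on root F"
    using forest_unique_tree[OF assms(2)] root_in_labels by (metis inj_onI)
  moreover have "root ` F \<subseteq> A"
    using assms(2) root_in_labels by (fastforce simp: forests_on_def)
  ultimately show ?thesis
    using assms(1) inj_on_finite by blast
qed

lemma subtree_Node_iff:
  "subtree s (Node a ts) \<longleftrightarrow> s = Node a ts \<or> (\<exists>t\<in>fset ts. subtree s t)"
  by (subst subtree.simps) auto

lemma subtree_labels: "subtree s t \<Longrightarrow> labels s \<subseteq> labels t"
  by (induction rule: subtree.induct) auto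

lemma subtree_root: "subtree s t \<Longrightarrow> root s \<in> labels t"
  using subtree_labels root_in_labels by blast

section \<open>Hook lengths under disjoint union and under adding a root\<close>

text \<open>A subtree with root \<open>u\<close> inside a tree of \<open>G\<close> would make
  \<open>u\<close> a vertex of \<open>G\<close>, so only trees of \<open>F\<close> contribute
  descendants of \<open>u\<close>.\<close>

lemma hook_length_Un:
  assumes "vertices F \<inter> vertices G = {}" "u \<in> vertices F"
  shows "hook_length (F \<union> G) u = hook_length F u"
proof -
  have "descendants (F \<union> G) u = descendants F u"
    using assms subtree_root unfolding descendants_def vertices_def by fast
  then show ?thesis by (simp add: hook_length_def)
qed

lemma vertices_Un: "vertices (F \<union> G) = vertices F \<union> vertices G"
  by (auto simp: vertices_def)

lemma hook_weight_Un:
  assumes "vertices F \<inter> vertices G = {}" "finite (vertices F)" "finite (vertices G)"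
  shows "hook_weight q (F \<union> G) = hook_weight q F * hook_weight q G"
proof -
  have "hook_length (F \<union> G) u = hook_length G u" if "u \<in> vertices G" for u
    using hook_length_Un[of G F] assms(1) that by (simp add: Un_commute Int_commute)
  then show ?thesis
    using assms by (simp add: hook_weight_def vertices_Un prod.union_disjoint hook_length_Un)
qed

text \<open>The label \<open>a\<close> does not occur in any child, so the whole tree is the only
  subtree with root \<open>a\<close>.\<close>

lemma hook_length_root:
  assumes "labeled_tree (Node a ts)"
  shows "hook_length {Node a ts} a = card (labels (Node a ts))"
proof -
  have "root s \<noteq> a" if "subtree s t" "t \<in> fset ts" for s t
    using that assms subtree_root[of s t] by (auto simp: labeled_tree_Node_iff)
  then have "subtree s (Node a ts) \<and> root s = a \<longleftrightarrow> s = Node a ts" for s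
    by (auto simp: subtree_Node_iff)
  then have "descendants {Node a ts} a = labels (Node a ts)"
    by (simp add: descendants_def conj_assoc[symmetric] del: rtree.set)
  then show ?thesis by (simp add: hook_length_def)
qed

lemma hook_length_Node:
  assumes "u \<noteq> a"
  shows "hook_length {Node a ts} u = hook_length (fset ts) u"
proof -
  have "descendants {Node a ts} u = descendants (fset ts) u"
    using assms unfolding descendants_def by (auto simp: subtree_Node_iff)
  then show ?thesis by (simp add: hook_length_def)
qed

lemma hook_weight_Node:
  assumes "labeled_tree (Node a ts)"
  shows "hook_weight q {Node a ts} = q (card (labels (Node a ts))) * hook_weight q (fset ts)"
proof -
  have a: "a \<notin> vertices (fset ts)"
    using assms by (simp add: labeled_tree_Node_iff_forest)
  have fin: "finite (vertices (fset ts))"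
    by (simp add: vertices_def finite_labels)
  have "vertices {Node a ts} = insert a (vertices (fset ts))"
    by (simp add: vertices_def)
  then have "hook_weight q {Node a ts} =
      q (hook_length {Node a ts} a) * (\<Prod>u\<in>vertices (fset ts). q (hook_length {Node a ts} u))"
    using a fin by (simp add: hook_weight_def)
  also have "(\<Prod>u\<in>vertices (fset ts). q (hook_length {Node a ts} u)) = hook_weight q (fset ts)"
    unfolding hook_weight_def
  proof (intro prod.cong refl)
    fix u assume "u \<in> vertices (fset ts)"
    with a have "u \<noteq> a" by blast
    then show "q (hook_length {Node a ts} u) = q (hook_length (fset ts) u)"
      by (simp add: hook_length_Node)
  qed
  finally show ?thesis
    by (simp only: hook_length_root[OF assms])
qed

section \<open>Decomposition bijections and finiteness\<close>

text \<open>Root deletion, with inverse reading off \<open>root\<close> and \<open>children\<close>.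
  Finiteness of \<open>A\<close> makes every \<open>F\<close> finite, so that
  \<open>Abs_fset\<close> loses nothing.\<close>

lemma bij_betw_trees_on:
  assumes "finite A"
  shows "bij_betw (\<lambda>(a, F). Node a (Abs_fset F)) (SIGMA a:A. forests_on (A - {a})) (trees_on A)"
proof (rule bij_betw_byWitness[where f' = "\<lambda>t. (root t, fset (children t))"])
  have fset_Abs: "fset (Abs_fset F) = F" if "F \<in> forests_on (A - {a})" for a F
    using finite_forest[OF _ that] assms by (simp add: Abs_fset_inverse)
  show "\<forall>p\<in>SIGMA a:A. forests_on (A - {a}).
      (\<lambda>t. (root t, fset (children t))) ((\<lambda>(a, F). Node a (Abs_fset F)) p) = p"
    using fset_Abs by auto
  show "\<forall>t\<in>trees_on A. (\<lambda>(a, F). Node a (Abs_fset F)) (root t, fset (children t)) = t"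
    by (simp add: fset_inverse)
  show "(\<lambda>(a, F). Node a (Abs_fset F)) ` (SIGMA a:A. forests_on (A - {a})) \<subseteq> trees_on A"
    by (auto simp: trees_on_def labeled_tree_Node_iff_forest labels_Node fset_Abs vertices_forest
        simp del: rtree.set)
  show "(\<lambda>t. (root t, fset (children t))) ` trees_on A \<subseteq> (SIGMA a:A. forests_on (A - {a}))"
  proof clarify
    fix t assume t: "t \<in> trees_on A"
    obtain a ts where "t = Node a ts" by (cases t)
    with t show "root t \<in> A \<and> fset (children t) \<in> forests_on (A - {root t})"
      by (auto simp: trees_on_def labeled_tree_Node_iff_forest labels_Node simp del: rtree.set)
  qed
qed

text \<open>Here \<open>t\<close> is the tree containing \<open>x\<close> and \<open>F\<close> the
  rest of the forest. The set \<open>S\<close> omits \<open>x\<close>, so it ranges over all subsets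
  of \<open>A - {x}\<close>, which later yields the binomial coefficient.\<close>

lemma bij_betw_forests_on:
  assumes "x \<in> A"
  shows "bij_betw (\<lambda>(S, t, F). insert t F)
    (SIGMA S:Pow (A - {x}). trees_on (insert x S) \<times> forests_on (A - {x} - S)) (forests_on A)"
    (is "bij_betw ?f ?D _")
proof (rule bij_betw_imageI)
  have ins: "insert t F \<in> forests_on A" "x \<in> labels t" "\<And>s. s \<in> F \<Longrightarrow> x \<notin> labels s" "t \<notin> F"
    if "(S, t, F) \<in> ?D" for S t F
  proof -
    show t: "x \<in> labels t" using that by (auto simp: trees_on_def)
    show F: "\<And>s. s \<in> F \<Longrightarrow> x \<notin> labels s" using that by (auto simp: forests_on_def)
    then show "t \<notin> F" using t by blast
    then show "insert t F \<in> forests_on A"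
      using that assms by (auto simp: trees_on_def forests_on_def disjoint_family_on_insert)
  qed
  show "inj_on ?f ?D"
  proof (rule inj_onI)
    fix p p' assume p: "p \<in> ?D" "p' \<in> ?D" "?f p = ?f p'"
    obtain S t F S' t' F' where p_eq: "p = (S, t, F)" "p' = (S', t', F')"
      by (metis prod_cases3)
    have D: "(S, t, F) \<in> ?D" "(S', t', F') \<in> ?D" and eq: "insert t F = insert t' F'"
      using p by (simp_all add: p_eq)
    \<comment> \<open>In the common forest, \<open>t\<close> and \<open>t'\<close> are both the only
      tree containing \<open>x\<close>.\<close>
    have "t = t'" using ins[OF D(1)] ins[OF D(2)] eq by blast
    moreover from this have "F = F'"
      using ins(4)[OF D(1)] ins(4)[OF D(2)] eq by (simp add: insert_ident)
    moreover have "S = S'" using D \<open>t = t'\<close> by (auto simp: trees_on_def)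
    ultimately show "p = p'" by (simp add: p_eq)
  qed
  show "?f ` ?D = forests_on A"
  proof
    show "?f ` ?D \<subseteq> forests_on A" using ins(1) by auto
    show "forests_on A \<subseteq> ?f ` ?D"
    proof
      fix G assume G: "G \<in> forests_on A"
      then obtain t where t: "t \<in> G" "x \<in> labels t"
        using assms by (auto simp: forests_on_def)
      have disj: "labels s \<inter> labels t = {}" if "s \<in> G - {t}" for s
        using forest_unique_tree[OF G] that t(1) by blast
      have "disjoint_family_on labels (G - {t})"
        using G by (auto simp: forests_on_def disjoint_family_on_def)
      moreover have "(\<Union>s\<in>G - {t}. labels s) = A - labels t"
        using G disj t(1) by (auto simp: forests_on_def)
      ultimately have "G - {t} \<in> forests_on (A - labels t)"
        using G by (auto simp: forests_on_def)
      moreover have "A - {x} - (labels t - {x}) = A - labels t" using t(2) by auto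
      moreover have "t \<in> trees_on (insert x (labels t - {x}))" "labels t \<subseteq> A"
        using G t by (auto simp: trees_on_def forests_on_def)
      ultimately have "(labels t - {x}, t, G - {t}) \<in> ?D" by auto
      moreover have "G = ?f (labels t - {x}, t, G - {t})" using t(1) by auto
      ultimately show "G \<in> ?f ` ?D" by (rule rev_image_eqI)
    qed
  qed
qed

lemma forests_on_empty: "forests_on {} = {{}}"
  using root_in_labels by (fastforce simp: forests_on_def disjoint_family_on_def)

text \<open>Both bijections together reduce forests on \<open>A\<close> to forests on proper subsets
  of \<open>A\<close>.\<close>

lemma finite_forests_on: "finite A \<Longrightarrow> finite (forests_on A)"
proof (induction A rule: finite_psubset_induct)
  case (psubset A)
  show ?case
  proof (cases "A = {}")
    case False
    then obtain x where x: "x \<in> A" by blast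
    have "finite (trees_on (insert x S))" if S: "S \<subseteq> A - {x}" for S
    proof -
      have "finite (insert x S)" using S psubset.hyps finite_subset by auto
      \<comment> \<open>\<open>insert x S\<close> may be all of \<open>A\<close>; only the deleted
        root makes the set strictly smaller.\<close>
      moreover have "insert x S - {a} \<subset> A" if "a \<in> insert x S" for a
        using S x that by auto
      ultimately show ?thesis
        by (intro iffD1[OF bij_betw_finite[OF bij_betw_trees_on]] finite_SigmaI psubset.IH)
    qed
    moreover have "finite (forests_on (A - {x} - S))" for S
      using x by (intro psubset.IH) auto
    ultimately show ?thesis
      using psubset.hyps by (intro iffD1[OF bij_betw_finite[OF bij_betw_forests_on[OF x]]]
          finite_SigmaI finite_cartesian_product) auto
  qed (simp add: forests_on_empty)
qed

lemma finite_trees_on: "finite A \<Longrightarrow> finite (trees_on A)"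
  using bij_betw_finite[OF bij_betw_trees_on, of A] by (auto intro!: finite_SigmaI finite_forests_on)

section \<open>The two recurrences for a general weight\<close>

text \<open>The root has hook length \<open>card A\<close> in every tree on \<open>A\<close>, so its
  factor leaves the sum.\<close>

lemma tree_sum_eq:
  assumes "finite A"
  shows "tree_sum q A = q (card A) * (\<Sum>a\<in>A. forest_sum q (A - {a}))"
proof -
  have w: "hook_weight q {Node a (Abs_fset F)} = q (card A) * hook_weight q F"
    if "a \<in> A" "F \<in> forests_on (A - {a})" for a F
  proof -
    have "Node a (Abs_fset F) \<in> trees_on A"
      using bij_betwE[OF bij_betw_trees_on[OF assms]] that by auto
    moreover have "fset (Abs_fset F) = F"
      using finite_forest[OF _ that(2)] assms by (simp add: Abs_fset_inverse)
    ultimately show ?thesis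
      by (simp add: trees_on_def hook_weight_Node del: rtree.set)
  qed
  have "tree_sum q A =
      (\<Sum>(a, F)\<in>(SIGMA a:A. forests_on (A - {a})). hook_weight q {Node a (Abs_fset F)})"
    unfolding tree_sum_def
    by (subst sum.reindex_bij_betw[OF bij_betw_trees_on[OF assms], symmetric])
      (simp add: case_prod_beta)
  also have "\<dots> = (\<Sum>a\<in>A. \<Sum>F\<in>forests_on (A - {a}). hook_weight q {Node a (Abs_fset F)})"
    using assms by (intro sum.Sigma[symmetric]) (auto intro: finite_forests_on)
  also have "\<dots> = q (card A) * (\<Sum>a\<in>A. forest_sum q (A - {a}))"
    by (simp add: w forest_sum_def sum_distrib_left)
  finally show ?thesis .
qed

text \<open>The weight is multiplicative over disjoint vertex sets, so for fixed \<open>S\<close>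
  the sum over pairs \<open>(t, F)\<close> factors.\<close>

lemma forest_sum_eq:
  assumes "finite A" "x \<in> A"
  shows "forest_sum q A =
    (\<Sum>S\<in>Pow (A - {x}). tree_sum q (insert x S) * forest_sum q (A - {x} - S))"
proof -
  let ?D = "SIGMA S:Pow (A - {x}). trees_on (insert x S) \<times> forests_on (A - {x} - S)"
  have fin: "finite S" if "S \<in> Pow (A - {x})" for S
    using that assms finite_subset by blast
  have w: "hook_weight q (insert t F) = hook_weight q {t} * hook_weight q F"
    if "S \<in> Pow (A - {x})" "t \<in> trees_on (insert x S)" "F \<in> forests_on (A - {x} - S)" for S t F
  proof -
    have "vertices {t} = insert x S" "vertices F = A - {x} - S"
      using that by (auto simp: trees_on_def vertices_def forests_on_def)
    then show ?thesis
      using hook_weight_Un[of "{t}" F q] fin[OF that(1)] assms by auto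
  qed
  have "forest_sum q A = (\<Sum>(S, t, F)\<in>?D. hook_weight q (insert t F))"
    unfolding forest_sum_def
    by (subst sum.reindex_bij_betw[OF bij_betw_forests_on[OF assms(2)], symmetric])
      (simp add: case_prod_beta)
  also have "\<dots> = (\<Sum>S\<in>Pow (A - {x}). \<Sum>(t, F)\<in>trees_on (insert x S) \<times> forests_on (A - {x} - S).
      hook_weight q (insert t F))"
    using assms fin by (intro sum.Sigma[symmetric]) (auto intro!: finite_trees_on finite_forests_on)
  also have "\<dots> = (\<Sum>S\<in>Pow (A - {x}). \<Sum>(t, F)\<in>trees_on (insert x S) \<times> forests_on (A - {x} - S).
      hook_weight q {t} * hook_weight q F)"
    by (intro sum.cong refl) (auto simp: w)
  also have "\<dots> = (\<Sum>S\<in>Pow (A - {x}). tree_sum q (insert x S) * forest_sum q (A - {x} - S))"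
    by (simp add: tree_sum_def forest_sum_def sum_product sum.cartesian_product)
  finally show ?thesis .
qed

section \<open>Evaluation for inverse squares\<close>

lemma sum_Pow_card:
  fixes g :: "nat \<Rightarrow> 'b::comm_semiring_1"
  assumes "finite B"
  shows "(\<Sum>S\<in>Pow B. g (card S)) = (\<Sum>j\<le>card B. of_nat (card B choose j) * g j)"
proof -
  have "(\<Sum>S\<in>Pow B. g (card S)) = (\<Sum>j\<le>card B. \<Sum>S\<in>{S \<in> Pow B. card S = j}. g (card S))"
    using assms by (intro sum.group[symmetric]) (auto intro: card_mono)
  also have "\<dots> = (\<Sum>j\<le>card B. of_nat (card B choose j) * g j)"
    using assms by (intro sum.cong refl) (simp add: n_subsets)
  finally show ?thesis .
qed

text \<open>Induction over label sets instead of \<open>n\<close> spares any relabelling: the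
  recurrences lead to sets such as \<open>insert x S - {a}\<close>, and the hypothesis covers all
  proper subsets of \<open>A\<close>.\<close>

lemma forest_sum_inverse_square:
  assumes "finite A"
  shows "forest_sum (\<lambda>h. 1 / (real h)\<^sup>2) A = fact (card A + 1) / 2 ^ card A"
  using assms
proof (induction A rule: finite_psubset_induct)
  case (psubset A)
  let ?q = "\<lambda>h. 1 / (real h)\<^sup>2"
  show ?case
  proof (cases "A = {}")
    case True
    then show ?thesis
      by (simp add: forest_sum_def forests_on_empty hook_weight_def vertices_def)
  next
    case False
    then obtain x where x: "x \<in> A" by blast
    define B where "B = A - {x}"
    define m where "m = card B"
    have finB: "finite B" and xB: "x \<notin> B" and A: "A = insert x B"
      using psubset.hyps x by (auto simp: B_def)
    have cardA: "card A = Suc m" using finB xB by (simp add: A m_def)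
    have tree: "tree_sum ?q (insert x S) = fact (card S) / 2 ^ card S" if S: "S \<subseteq> B" for S
    proof -
      have finS: "finite S" and xS: "x \<notin> S" using S finB xB finite_subset by auto
      have "forest_sum ?q (insert x S - {a}) = fact (card S + 1) / 2 ^ card S"
        if a: "a \<in> insert x S" for a
      proof -
        have "insert x S - {a} \<subset> A" using a S A by blast
        moreover have "card (insert x S - {a}) = card S" using a finS xS by simp
        ultimately show ?thesis using psubset.IH by metis
      qed
      \<comment> \<open>All \<open>card S + 1\<close> choices of the root give the same forest
        sum.\<close>
      then have "tree_sum ?q (insert x S) =
          1 / (real (Suc (card S)))\<^sup>2 * (real (Suc (card S)) * (fact (card S + 1) / 2 ^ card S))"
        using finS xS by (simp add: tree_sum_eq)
      also have "\<dots> = fact (card S) / 2 ^ card S"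
        by (simp add: power2_eq_square)
      finally show ?thesis .
    qed
    have forest: "forest_sum ?q (B - S) = fact (m - card S + 1) / 2 ^ (m - card S)"
      if S: "S \<subseteq> B" for S
    proof -
      have "B - S \<subset> A" using A xB by blast
      moreover have "card (B - S) = m - card S"
        using card_Diff_subset[OF finite_subset[OF S finB] S] by (simp add: m_def)
      ultimately show ?thesis using psubset.IH by metis
    qed
    have "forest_sum ?q A = (\<Sum>S\<in>Pow B. tree_sum ?q (insert x S) * forest_sum ?q (B - S))"
      using forest_sum_eq[OF psubset.hyps x] by (simp add: B_def)
    also have "\<dots> = (\<Sum>S\<in>Pow B.
        fact (card S) / 2 ^ card S * (fact (m - card S + 1) / 2 ^ (m - card S)))"
      by (intro sum.cong refl) (simp only: Pow_iff tree forest)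
    also have "\<dots> = (\<Sum>j\<le>m. real (m choose j) *
        (fact j / 2 ^ j * (fact (m - j + 1) / 2 ^ (m - j))))"
      using sum_Pow_card[OF finB, of "\<lambda>j. fact j / 2 ^ j * (fact (m - j + 1) / 2 ^ (m - j))"]
      by (simp only: m_def)
    also have "\<dots> = (\<Sum>j\<le>m. fact m / 2 ^ m * real (m - j + 1))"
    proof (intro sum.cong refl)
      fix j assume "j \<in> {..m}"
      then have j: "j \<le> m" by simp
      \<comment> \<open>The binomial coefficient absorbs \<open>fact j\<close> and
        \<open>fact (m - j)\<close> into \<open>fact m\<close>; the top factor of
        \<open>fact (m - j + 1)\<close> survives.\<close>
      have "(2::real) ^ m = 2 ^ j * 2 ^ (m - j)"
        using j by (simp flip: power_add)
      moreover have "(fact m :: real) = real (m choose j) * fact j * fact (m - j)"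
        using j by (simp add: binomial_fact)
      ultimately show "real (m choose j) * (fact j / 2 ^ j * (fact (m - j + 1) / 2 ^ (m - j)))
          = fact m / 2 ^ m * real (m - j + 1)"
        by simp
    qed
    also have "\<dots> = fact m / 2 ^ m * (\<Sum>j\<le>m. real (m - j + 1))"
      by (simp add: sum_distrib_left)
    \<comment> \<open>Reversing the order of summation removes the truncated subtraction.\<close>
    also have "(\<Sum>j\<le>m. real (m - j + 1)) = (\<Sum>j\<le>m. real (j + 1))"
      by (rule sum.reindex_bij_witness[of _ "\<lambda>j. m - j" "\<lambda>j. m - j"]) auto
    also have "(\<Sum>j\<le>m. real (j + 1)) = real (m + 1) * real (m + 2) / 2"
      by (induction m) (auto simp: field_simps)
    \<comment> \<open>Since \<open>card A = m + 1\<close>, the two linear factors complete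
      \<open>fact (m + 2)\<close> and the halving supplies the last power of 2.\<close>
    also have "fact m / 2 ^ m * (real (m + 1) * real (m + 2) / 2) = fact (card A + 1) / 2 ^ card A"
      by (simp add: cardA field_simps)
    finally show ?thesis .
  qed
qed

theorem theorem4p10:
  fixes n :: nat
  assumes "n \<ge> 1"
  shows "(\<Sum>F\<in>labeled_forests n. \<Prod>h\<in>#hook_lengths F. 1 / (real h)\<^sup>2) = fact (n + 1) / 2 ^ n"
proof -
  \<comment> \<open>The multiset keeps multiplicities, so its product is the product over
    vertices.\<close>
  have "(\<Prod>h\<in>#hook_lengths F. 1 / (real h)\<^sup>2) = hook_weight (\<lambda>h. 1 / (real h)\<^sup>2) F"
    for F :: "nat rtree set"
    by (simp add: hook_lengths_def hook_weight_def prod_unfold_prod_mset multiset.map_comp comp_def)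
  then show ?thesis
    using forest_sum_inverse_square[of "{1..n}"] by (simp add: forest_sum_def)
qed

end
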